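(* Let $H\subset\mathbb R^2$ be a hypergraph and let $F$ be a closed subset of $H$. Then $F$ is zero-dimensional if and only if $F$ has empty interior in $H$.
   Context: A space is zero-dimensional if it has a basis of clopen sets; the empty space counts as zero-dimensional. "Closed" and "interior" are relative to the subspace $H$ of $\mathbb R^2$. For $f:P\subset\mathbb R\to\mathbb R$ and $a\in\overline P$, let $\Omega f(a)$ be the set of all real numbers of the form $\lim_j f(x_j)$ with $x_j\in P$, $\lim_j x_j=a$; $\Omega^-f(a)$ (resp. $\Omega^+f(a)$) is defined in the same way with the extra requirement $x_j\le a$ (resp. $x_j\ge a$) for all $j$. Hypergraph: a set $H\subset\mathbb R^2$ is a hypergraph if there are a non-trivial interval $I\subset\mathbb R$, a countable subset $Q$ of $I$, and a continuous function $f:P=I\setminus Q\to\mathbb R$ with graph $G$ such that (a) for all $a\in Q$, $\Omega f(a)$ is a non-trivial interval, and $\Omega f(a)=\Omega^-f(a)=\Omega^+f(a)$ (if $a$ is an endpoint of $I$, only the one-sided set on the side of $I$ is considered); (b) for all $a\in Q$ there is a continuous $g:I\setminus\{a\}\to\mathbb R$ such that $f-g:P\to\mathbb R$ has a (finite) limit at $a$; (c) $G\subset H\subset\overline G\cap(I\times\mathbb R)$, where $\overline G$ is the closure of $G$ in $\mathbb R^2$, and for all $a\in Q$ the section $H(a)=\{y:(a,y)\in H\}$ is dense and of empty interior in $\overline G(a)=\{y:(a,y)\in\overline G\}$. *)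

theory Defs
  imports "HOL-Analysis.Analysis"
begin

definition zero_dimensional_space :: "'a topology \<Rightarrow> bool" where
  "zero_dimensional_space X \<longleftrightarrow>
     (\<exists>\<B>. (\<forall>U\<in>\<B>. openin X U \<and> closedin X U) \<and>
          openin X = arbitrary union_of (\<lambda>U. U \<in> \<B>))"

definition nontrivial_interval :: "real set \<Rightarrow> bool" where
  "nontrivial_interval I \<longleftrightarrow> is_interval I \<and> (\<exists>x\<in>I. \<exists>y\<in>I. x < y)"

text \<open>
  A partial function \<open>f : P \<rightarrow> \<real>\<close> is a total \<open>f\<close> together with its domain \<open>P\<close>; values of
  \<open>f\<close> outside \<open>P\<close> are never used. Only finite limits count as elements of the cluster sets.
\<close>

definition cluster_set :: "real set \<Rightarrow> (real \<Rightarrow> real) \<Rightarrow> real \<Rightarrow> real set" where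
  "cluster_set P f a =
     {y. \<exists>x. (\<forall>j::nat. x j \<in> P) \<and> x \<longlonglongrightarrow> a \<and> (\<lambda>j. f (x j)) \<longlonglongrightarrow> y}"

definition cluster_set_left :: "real set \<Rightarrow> (real \<Rightarrow> real) \<Rightarrow> real \<Rightarrow> real set" where
  "cluster_set_left P f a =
     {y. \<exists>x. (\<forall>j::nat. x j \<in> P \<and> x j \<le> a) \<and> x \<longlonglongrightarrow> a \<and> (\<lambda>j. f (x j)) \<longlonglongrightarrow> y}"

definition cluster_set_right :: "real set \<Rightarrow> (real \<Rightarrow> real) \<Rightarrow> real \<Rightarrow> real set" where
  "cluster_set_right P f a =
     {y. \<exists>x. (\<forall>j::nat. x j \<in> P \<and> x j \<ge> a) \<and> x \<longlonglongrightarrow> a \<and> (\<lambda>j. f (x j)) \<longlonglongrightarrow> y}"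

definition graph_on :: "real set \<Rightarrow> (real \<Rightarrow> real) \<Rightarrow> (real \<times> real) set" where
  "graph_on P f = {(x, f x) | x. x \<in> P}"

definition vsection :: "(real \<times> real) set \<Rightarrow> real \<Rightarrow> real set" where
  "vsection H a = {y. (a, y) \<in> H}"

text \<open>
  The guards \<open>\<exists>x\<in>I. x < a\<close> and \<open>\<exists>x\<in>I. a < x\<close> drop the left (right) cluster set exactly when
  \<open>a\<close> is the left (right) endpoint of \<open>I\<close>.
\<close>

definition hypergraph :: "(real \<times> real) set \<Rightarrow> bool" where
  "hypergraph H \<longleftrightarrow>
     (\<exists>I Q f. nontrivial_interval I \<and> Q \<subseteq> I \<and> countable Q \<and> continuous_on (I - Q) f \<and>
        (\<forall>a\<in>Q. nontrivial_interval (cluster_set (I - Q) f a) \<and>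
               ((\<exists>x\<in>I. x < a) \<longrightarrow> cluster_set (I - Q) f a = cluster_set_left (I - Q) f a) \<and>
               ((\<exists>x\<in>I. a < x) \<longrightarrow> cluster_set (I - Q) f a = cluster_set_right (I - Q) f a)) \<and>
        (\<forall>a\<in>Q. \<exists>g l. continuous_on (I - {a}) g \<and>
               ((\<lambda>x. f x - g x) \<longlongrightarrow> l) (at a within (I - Q))) \<and>
        graph_on (I - Q) f \<subseteq> H \<and>
        H \<subseteq> closure (graph_on (I - Q) f) \<inter> (I \<times> UNIV) \<and>
        (\<forall>a\<in>Q. let S = vsection (closure (graph_on (I - Q) f)) a in
               top_of_set S closure_of vsection H a = S \<and>
               top_of_set S interior_of vsection H a = {}))"

end

theory Submission
  imports Defs
begin

text \<open>
  A hypergraph \<open>H\<close> is connected. If \<open>A\<close>, \<open>B\<close> were a clopen partition of \<open>H\<close>, the points of \<open>I\<close>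
  at which both parts of the graph accumulate would form a non-empty subset of \<open>Q\<close>, closed in
  \<open>I\<close>; a countable closed set has an isolated point \<open>a\<close>, and near \<open>a\<close> the graph lies in one part
  on the left and in the other on the right. The two one-sided cluster sets at \<open>a\<close> agree, so each
  point of \<open>H\<close> over \<open>a\<close> would lie in both parts. A zero-dimensional subset with an interior point
  would give a small clopen subset of \<open>H\<close>, contradicting connectedness.

  Conversely, if \<open>F\<close> is closed with empty interior, then the vertical lines missing \<open>F\<close> are dense.
  Over a neighbourhood of \<open>a\<close>, \<open>F\<close> follows a function \<open>g\<close> continuous off \<open>a\<close>, with an error that
  tends to \<open>0\<close> at \<open>a\<close>. Cutting along vertical lines that miss \<open>F\<close> replaces \<open>g\<close> by a function that
  is locally constant on the projection of \<open>F\<close>. Its values between two levels \<open>c\<^sub>1 < y < c\<^sub>2\<close> missed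
  by \<open>F\<close> over \<open>a\<close> define small clopen neighbourhoods of \<open>(a, y)\<close> in \<open>F\<close>.
\<close>

section \<open>Zero-dimensionality, closures of graphs and cluster sets\<close>

lemma zero_dimensional_space_iff:
  "zero_dimensional_space X \<longleftrightarrow>
     (\<forall>U x. openin X U \<and> x \<in> U \<longrightarrow>
        (\<exists>V. openin X V \<and> closedin X V \<and> x \<in> V \<and> V \<subseteq> U))"
  (is "?L \<longleftrightarrow> ?R")
proof
  assume ?L
  then obtain \<B> where \<B>: "\<forall>U\<in>\<B>. openin X U \<and> closedin X U"
      and base: "openin X = arbitrary union_of (\<lambda>U. U \<in> \<B>)"
    unfolding zero_dimensional_space_def by (elim exE conjE)
  show ?R
  proof (intro allI impI)
    fix U x assume "openin X U \<and> x \<in> U"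
    then obtain V where "V \<in> \<B>" "x \<in> V" "V \<subseteq> U"
      using iffD1[OF openin_topology_base_unique base] by blast
    with \<B> show "\<exists>V. openin X V \<and> closedin X V \<and> x \<in> V \<and> V \<subseteq> U" by blast
  qed
next
  assume R: ?R
  show ?L
    unfolding zero_dimensional_space_def
  proof (intro exI conjI)
    let ?\<B> = "{U. openin X U \<and> closedin X U}"
    show "\<forall>U\<in>?\<B>. openin X U \<and> closedin X U" by simp
    show "openin X = arbitrary union_of (\<lambda>U. U \<in> ?\<B>)"
      by (rule iffD2[OF openin_topology_base_unique]) (use R in auto)
  qed
qed

lemma clopen_if_locally_constant:
  assumes "V \<subseteq> F"
    and loc: "\<And>p. p \<in> F \<Longrightarrow> \<exists>T. open T \<and> p \<in> T \<and> (\<forall>q\<in>F \<inter> T. q \<in> V \<longleftrightarrow> p \<in> V)"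
  shows "openin (top_of_set F) V \<and> closedin (top_of_set F) V"
proof -
  have "openin (top_of_set F) V"
  proof (subst openin_subopen, intro ballI)
    fix p assume "p \<in> V"
    with assms obtain T where "open T" "p \<in> T" "\<forall>q\<in>F \<inter> T. q \<in> V"
      by (metis subsetD)
    with \<open>p \<in> V\<close> assms(1) show "\<exists>T. openin (top_of_set F) T \<and> p \<in> T \<and> T \<subseteq> V"
      by (intro exI[of _ "F \<inter> T"]) auto
  qed
  moreover have "openin (top_of_set F) (F - V)"
  proof (subst openin_subopen, intro ballI)
    fix p assume "p \<in> F - V"
    with loc obtain T where "open T" "p \<in> T" "\<forall>q\<in>F \<inter> T. q \<notin> V"
      by (metis DiffE)
    with \<open>p \<in> F - V\<close> show "\<exists>T. openin (top_of_set F) T \<and> p \<in> T \<and> T \<subseteq> F - V"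
      by (intro exI[of _ "F \<inter> T"]) auto
  qed
  ultimately show ?thesis
    using assms(1) by (simp add: closedin_def)
qed

lemma closure_graph_on_iff:
  "(a, y) \<in> closure (graph_on P f) \<longleftrightarrow> y \<in> cluster_set P f a"
proof
  assume "(a, y) \<in> closure (graph_on P f)"
  then obtain s where s: "\<And>n. s n \<in> graph_on P f" "s \<longlonglongrightarrow> (a, y)"
    unfolding closure_sequential by blast
  have "\<And>n. fst (s n) \<in> P \<and> f (fst (s n)) = snd (s n)"
    using s(1) unfolding graph_on_def by (smt (verit, best) fst_conv mem_Collect_eq snd_conv)
  moreover have "(\<lambda>n. fst (s n)) \<longlonglongrightarrow> a" "(\<lambda>n. snd (s n)) \<longlonglongrightarrow> y"
    using tendsto_fst[OF s(2)] tendsto_snd[OF s(2)] by simp_all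
  ultimately show "y \<in> cluster_set P f a"
    unfolding cluster_set_def by (intro CollectI exI[of _ "\<lambda>n. fst (s n)"]) simp
next
  assume "y \<in> cluster_set P f a"
  then obtain x where x: "\<forall>j::nat. x j \<in> P" "x \<longlonglongrightarrow> a" "(\<lambda>j. f (x j)) \<longlonglongrightarrow> y"
    unfolding cluster_set_def by blast
  then show "(a, y) \<in> closure (graph_on P f)"
    unfolding closure_sequential
    by (intro exI[of _ "\<lambda>j. (x j, f (x j))"]) (auto simp: graph_on_def intro: tendsto_Pair)
qed

text \<open>Together with \<open>closure_graph_on_iff\<close>, this makes the section of the closed
  graph over a point of the domain a single point.\<close>

lemma cluster_set_continuous:
  assumes "continuous_on P f" "a \<in> P" "y \<in> cluster_set P f a"
  shows "y = f a"
proof -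
  obtain x where x: "\<forall>j::nat. x j \<in> P" "x \<longlonglongrightarrow> a" "(\<lambda>j. f (x j)) \<longlonglongrightarrow> y"
    using assms(3) unfolding cluster_set_def by blast
  have "(\<lambda>j. f (x j)) \<longlonglongrightarrow> f a"
    using assms x by (auto intro: continuous_on_tendsto_compose)
  then show ?thesis
    using x(3) LIMSEQ_unique by blast
qed

section \<open>Step functions and small clopen neighbourhoods\<close>

text \<open>Cover \<open>I - {a}\<close> by intervals with endpoints in \<open>D\<close> on which
  \<open>g\<close> is nearly constant, pass to a countable subcover, and let \<gamma> take the
  constant of the first interval that contains the point. On \<open>I - {a}\<close> the choice of
  interval can change only at endpoints, which lie in \<open>D\<close>.\<close>

lemma step_approximation:
  fixes g :: "real \<Rightarrow> real"
  assumes cont: "continuous_on (I - {a}) g"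
    and dense: "\<And>u v. u < v \<Longrightarrow> \<exists>d\<in>D. u < d \<and> d < v"
  obtains \<gamma> where "\<And>x. x \<in> I - {a} \<Longrightarrow> \<bar>\<gamma> x - g x\<bar> \<le> \<bar>x - a\<bar>"
    and "\<And>x. x \<in> I - {a} - D \<Longrightarrow> \<exists>T. open T \<and> x \<in> T \<and> (\<forall>x'\<in>T. \<gamma> x' = \<gamma> x)"
proof -
  \<comment> \<open>The permitted error vanishes at \<open>a\<close>, so the step function inherits
    the limiting behaviour of \<open>g\<close> there.\<close>
  define approx where "approx U c \<longleftrightarrow> (\<forall>x\<in>U \<inter> (I - {a}). \<bar>c - g x\<bar> \<le> \<bar>x - a\<bar>)" for U c
  define \<U> where "\<U> = {U. \<exists>s\<in>D. \<exists>t\<in>D. U = {s<..<t} \<and> (\<exists>c. approx U c)}"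
  have "\<And>U. U \<in> \<U> \<Longrightarrow> open U"
    unfolding \<U>_def by auto
  then obtain \<U>' where \<U>': "\<U>' \<subseteq> \<U>" "countable \<U>'" "\<Union>\<U>' = \<Union>\<U>"
    by (rule Lindelof) auto
  have cover: "I - {a} \<subseteq> \<Union>\<U>"
  proof
    fix x assume x: "x \<in> I - {a}"
    \<comment> \<open>Points within \<open>e\<close> of \<open>x\<close> stay farther than
      \<open>e\<close> from \<open>a\<close>, so a variation of \<open>g\<close> below
      \<open>e\<close> is within the permitted error.\<close>
    define e where "e = \<bar>x - a\<bar> / 2"
    have "e > 0" using x by (simp add: e_def)
    then obtain d where d: "d > 0" "\<And>x'. x' \<in> I - {a} \<Longrightarrow> dist x' x < d \<Longrightarrow> dist (g x') (g x) < e"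
      using cont x unfolding continuous_on_iff by blast
    define r where "r = min d e"
    have "r > 0" using d \<open>e > 0\<close> by (simp add: r_def)
    obtain s where s: "s \<in> D" "x - r < s" "s < x"
      using dense[of "x - r" x] \<open>r > 0\<close> by auto
    obtain t where t: "t \<in> D" "x < t" "t < x + r"
      using dense[of x "x + r"] \<open>r > 0\<close> by auto
    have "approx {s<..<t} (g x)"
      unfolding approx_def
    proof
      fix x' assume x': "x' \<in> {s<..<t} \<inter> (I - {a})"
      then have "\<bar>x' - x\<bar> < r" using s t by auto
      then have "\<bar>g x' - g x\<bar> < e" "\<bar>x' - x\<bar> < e"
        using d(2)[of x'] x' by (auto simp: dist_real_def r_def)
      moreover have "\<bar>x - a\<bar> \<le> \<bar>x' - x\<bar> + \<bar>x' - a\<bar>"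
        by linarith
      ultimately show "\<bar>g x - g x'\<bar> \<le> \<bar>x' - a\<bar>"
        unfolding e_def abs_minus_commute[of "g x"] by argo
    qed
    then show "x \<in> \<Union>\<U>"
      unfolding \<U>_def using s t by (intro UnionI[of "{s<..<t}"]) auto
  qed
  obtain d0 where "d0 \<in> D" using dense[of 0 1] by auto
  \<comment> \<open>The empty interval (equal endpoints) is added to the subcover because an
    enumeration by the naturals needs a non-empty family.\<close>
  have "{} \<in> \<U>"
    unfolding \<U>_def approx_def using \<open>d0 \<in> D\<close> by (intro CollectI bexI[of _ d0]) auto
  define U where "U = from_nat_into (insert {} \<U>')"
  have range_U: "range U = insert {} \<U>'"
    unfolding U_def using \<U>'(2) by (intro range_from_nat_into) auto
  have U: "U n \<in> \<U>" for n
  proof -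
    have "U n \<in> insert {} \<U>'" using range_U rangeI by metis
    then show ?thesis using \<U>'(1) \<open>{} \<in> \<U>\<close> by auto
  qed
  then have "\<exists>c. approx (U n) c" for n
    using U[of n] unfolding \<U>_def by auto
  then obtain c where c: "\<And>n. approx (U n) (c n)" by metis
  define N where "N x = (LEAST n. x \<in> U n)" for x
  have N: "x \<in> U (N x)" if "x \<in> I - {a}" for x
  proof -
    have "x \<in> \<Union>\<U>'" using that cover \<U>'(3) by auto
    then obtain W where "W \<in> range U" "x \<in> W" unfolding range_U by auto
    then have "\<exists>n. x \<in> U n" by auto
    then show ?thesis unfolding N_def by (rule LeastI_ex)
  qed
  show ?thesis
  proof
    show "\<bar>c (N x) - g x\<bar> \<le> \<bar>x - a\<bar>" if "x \<in> I - {a}" for x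
      using c[of "N x"] N[OF that] that unfolding approx_def by blast
    show "\<exists>T. open T \<and> x \<in> T \<and> (\<forall>x'\<in>T. c (N x') = c (N x))" if x: "x \<in> I - {a} - D" for x
    proof (intro exI conjI ballI)
      \<comment> \<open>On the first interval containing \<open>x\<close>, minus the closures of the
        earlier ones, the least index is constant. The earlier intervals miss \<open>x\<close>, and
        so do their endpoints, which lie in \<open>D\<close> while \<open>x\<close> does
        not.\<close>
      let ?T = "U (N x) \<inter> (\<Inter>j<N x. - closure (U j))"
      have "open (U n)" for n
        using U[of n] unfolding \<U>_def by auto
      then show "open ?T" by auto
      have "x \<notin> closure (U j)" if "j < N x" for j
      proof -
        obtain s t where st: "s \<in> D" "t \<in> D" "U j = {s<..<t}"
          using U[of j] unfolding \<U>_def by blast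
        have "closure (U j) \<subseteq> {s..t}"
          unfolding st by (rule closure_minimal) auto
        moreover have "x \<notin> U j"
          using that not_less_Least unfolding N_def by blast
        ultimately show ?thesis
          using st x by force
      qed
      then show "x \<in> ?T" using N x by blast
      fix x' assume x': "x' \<in> ?T"
      have "N x' = N x"
        unfolding N_def[of x']
      proof (rule Least_equality)
        show "x' \<in> U (N x)" using x' by blast
        show "N x \<le> n" if "x' \<in> U n" for n
          using that x' closure_subset by (metis (no_types, lifting) ComplD IntD2 INT_D lessThan_iff not_le subsetD)
      qed
      then show "c (N x') = c (N x)" by simp
    qed
  qed
qed

text \<open>The neighbourhood is a box whose vertical sides lie over points of \<open>D\<close> and
  whose height is measured by a modified coordinate. The bounding levels have to avoid
  \<open>F\<close> only over \<open>a\<close>: elsewhere the modified height is locally constant on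
  the projection of \<open>F\<close>.\<close>

lemma small_clopen_neighbourhood:
  fixes F :: "(real \<times> real) set"
  assumes F: "F \<subseteq> I \<times> UNIV"
    and D: "\<And>x z. (x, z) \<in> F \<Longrightarrow> x \<notin> D"
    and dense: "\<And>u v. u < v \<Longrightarrow> \<exists>d\<in>D. u < d \<and> d < v"
    and cont: "continuous_on (I - {a}) g"
    and near: "\<And>e. e > 0 \<Longrightarrow>
                 \<exists>d>0. \<forall>x z. (x, z) \<in> F \<and> x \<noteq> a \<and> \<bar>x - a\<bar> < d \<longrightarrow> \<bar>z - g x\<bar> \<le> e"
    and gap: "\<And>u v. u < v \<Longrightarrow> \<exists>c. u < c \<and> c < v \<and> (a, c) \<notin> F"
    and p: "(a, y) \<in> F"
    and "e > 0"
  shows "\<exists>V. openin (top_of_set F) V \<and> closedin (top_of_set F) V \<and> (a, y) \<in> V \<and> V \<subseteq> ball (a, y) e"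
proof -
  obtain \<gamma> where \<gamma>: "\<And>x. x \<in> I - {a} \<Longrightarrow> \<bar>\<gamma> x - g x\<bar> \<le> \<bar>x - a\<bar>"
    and \<gamma>_const: "\<And>x. x \<in> I - {a} - D \<Longrightarrow> \<exists>T. open T \<and> x \<in> T \<and> (\<forall>x'\<in>T. \<gamma> x' = \<gamma> x)"
    using step_approximation[OF cont dense] by metis
  \<comment> \<open>a continuous function on \<open>F\<close>, locally constant off the line over \<open>a\<close>\<close>
  define \<phi> where "\<phi> x z = (if x = a then z else \<gamma> x)" for x z
  have \<phi>_near: "\<exists>d>0. \<forall>x z. (x, z) \<in> F \<and> \<bar>x - a\<bar> < d \<longrightarrow> \<bar>\<phi> x z - z\<bar> < r" if "r > 0" for r
  proof -
    obtain d where d: "d > 0" "\<And>x z. (x, z) \<in> F \<Longrightarrow> x \<noteq> a \<Longrightarrow> \<bar>x - a\<bar> < d \<Longrightarrow> \<bar>z - g x\<bar> \<le> r / 2"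
      using near[of "r / 2"] \<open>r > 0\<close> by auto
    \<comment> \<open>One half of \<open>r\<close> pays for \<gamma> against \<open>g\<close>, the
      other for \<open>z\<close> against \<open>g\<close>.\<close>
    have "\<bar>\<phi> x z - z\<bar> < r" if "(x, z) \<in> F" "\<bar>x - a\<bar> < min d (r / 2)" for x z
    proof (cases "x = a")
      case False
      then have "\<bar>\<gamma> x - g x\<bar> \<le> \<bar>x - a\<bar>" "\<bar>z - g x\<bar> \<le> r / 2"
        using that F d \<gamma> by auto
      then show ?thesis
        using that False abs_triangle_ineq4[of "\<gamma> x - g x" "z - g x"] unfolding \<phi>_def by simp
    qed (simp add: \<phi>_def \<open>r > 0\<close>)
    then show ?thesis
      using d(1) \<open>r > 0\<close> by (intro exI[of _ "min d (r / 2)"]) auto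
  qed
  obtain d where d: "d > 0" "\<And>x z. (x, z) \<in> F \<Longrightarrow> \<bar>x - a\<bar> < d \<Longrightarrow> \<bar>\<phi> x z - z\<bar> < e / 4"
    using \<phi>_near[of "e / 4"] \<open>e > 0\<close> by auto
  \<comment> \<open>In the final estimate \<open>x\<close> against \<open>a\<close>,
    \<open>z\<close> against \<phi>, and \<phi> against \<open>y\<close> each cost less than
    \<open>e / 4\<close>.\<close>
  define r where "r = min d (e / 4)"
  have "r > 0" using d \<open>e > 0\<close> by (simp add: r_def)
  obtain s where s: "s \<in> D" "a - r < s" "s < a"
    using dense[of "a - r" a] \<open>r > 0\<close> by auto
  obtain t where t: "t \<in> D" "a < t" "t < a + r"
    using dense[of a "a + r"] \<open>r > 0\<close> by auto
  obtain c1 where c1: "(a, c1) \<notin> F" "y - e / 4 < c1" "c1 < y"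
    using gap[of "y - e / 4" y] \<open>e > 0\<close> by auto
  obtain c2 where c2: "(a, c2) \<notin> F" "y < c2" "c2 < y + e / 4"
    using gap[of y "y + e / 4"] \<open>e > 0\<close> by auto
  define V where "V = {(x, z). (x, z) \<in> F \<and> s < x \<and> x < t \<and> c1 < \<phi> x z \<and> \<phi> x z < c2}"
  have "\<exists>T. open T \<and> p \<in> T \<and> (\<forall>q\<in>F \<inter> T. q \<in> V \<longleftrightarrow> p \<in> V)" if "p \<in> F" for p
  proof -
    obtain x z where xz: "p = (x, z)" by (cases p)
    \<comment> \<open>Since \<open>F\<close> has no point over \<open>s\<close> or \<open>t\<close>,
      the condition \<open>s < x < t\<close> is constant near every \<open>x\<close> in its
      projection.\<close>
    define B where "B = (if s < x \<and> x < t then {s<..<t} else - {s..t})"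
    have B: "open B" "x \<in> B" "\<And>x'. x' \<in> B \<Longrightarrow> s < x' \<and> x' < t \<longleftrightarrow> s < x \<and> x < t"
      using D[of x z] \<open>p \<in> F\<close> xz s t by (auto simp: B_def intro: open_Compl split: if_splits)
    show ?thesis
    proof (cases "x = a")
      case False
      \<comment> \<open>Here the comparison with \<open>c1\<close> and \<open>c2\<close> depends on
        \<gamma> alone, so local constancy settles it even if \<gamma> takes the value
        \<open>c1\<close> or \<open>c2\<close>.\<close>
      then obtain T where T: "open T" "x \<in> T" "\<And>x'. x' \<in> T \<Longrightarrow> \<gamma> x' = \<gamma> x"
        using \<gamma>_const[of x] D[of x z] F \<open>p \<in> F\<close> xz by blast
      show ?thesis
      proof (intro exI conjI ballI)
        show "open ((B \<inter> T \<inter> - {a}) \<times> (UNIV :: real set))"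
          using B T by (intro open_Times) auto
        show "p \<in> (B \<inter> T \<inter> - {a}) \<times> UNIV" using B T False xz by auto
        show "q \<in> V \<longleftrightarrow> p \<in> V" if "q \<in> F \<inter> ((B \<inter> T \<inter> - {a}) \<times> UNIV)" for q
          using that B(3) T(3) False \<open>p \<in> F\<close> unfolding V_def \<phi>_def xz by (cases q) auto
      qed
    next
      case True
      then have "z \<noteq> c1" "z \<noteq> c2" using \<open>p \<in> F\<close> xz c1 c2 by auto
      \<comment> \<open>The distance from \<open>z\<close> to the levels is halved: one \<rho> for
        moving from \<open>z\<close> to a nearby \<open>z'\<close>, one for passing from
        \<open>z'\<close> to \<phi>.\<close>
      define \<rho> where "\<rho> = min \<bar>z - c1\<bar> \<bar>z - c2\<bar> / 2"
      have "\<rho> > 0" using \<open>z \<noteq> c1\<close> \<open>z \<noteq> c2\<close> by (simp add: \<rho>_def)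
      then obtain \<delta> where \<delta>: "\<delta> > 0" "\<And>x z. (x, z) \<in> F \<Longrightarrow> \<bar>x - a\<bar> < \<delta> \<Longrightarrow> \<bar>\<phi> x z - z\<bar> < \<rho>"
        using \<phi>_near[of \<rho>] by auto
      show ?thesis
      proof (intro exI conjI ballI)
        let ?T = "(B \<inter> {a - \<delta><..<a + \<delta>}) \<times> {z - \<rho><..<z + \<rho>}"
        show "open ?T"
          using B by (intro open_Times) auto
        show "p \<in> ?T" using B \<delta> \<open>\<rho> > 0\<close> True xz by auto
        show "q \<in> V \<longleftrightarrow> p \<in> V" if "q \<in> F \<inter> ?T" for q
        proof -
          obtain x' z' where q: "q = (x', z')" by (cases q)
          have "\<bar>\<phi> x' z' - z'\<bar> < \<rho>" "\<bar>z' - z\<bar> < \<rho>"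
            using that \<delta>(2)[of x' z'] q by auto
          then have "\<bar>\<phi> x' z' - z\<bar> < 2 * \<rho>"
            by linarith
          then have "\<bar>\<phi> x' z' - z\<bar> < \<bar>z - c1\<bar>" "\<bar>\<phi> x' z' - z\<bar> < \<bar>z - c2\<bar>"
            unfolding \<rho>_def by simp_all
          then have "c1 < \<phi> x' z' \<longleftrightarrow> c1 < z" "\<phi> x' z' < c2 \<longleftrightarrow> z < c2"
            by linarith+
          moreover have "\<phi> x z = z" using True by (simp add: \<phi>_def)
          ultimately show ?thesis
            using that B(3)[of x'] \<open>p \<in> F\<close> unfolding V_def xz q by auto
        qed
      qed
    qed
  qed
  moreover have "V \<subseteq> F" unfolding V_def by auto
  ultimately have "openin (top_of_set F) V \<and> closedin (top_of_set F) V"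
    by (intro clopen_if_locally_constant)
  moreover have "(a, y) \<in> V"
    using p s t c1 c2 by (simp add: V_def \<phi>_def)
  moreover have "V \<subseteq> ball (a, y) e"
  proof
    fix q assume "q \<in> V"
    then obtain x z where q: "q = (x, z)" "(x, z) \<in> F" "s < x" "x < t" "c1 < \<phi> x z" "\<phi> x z < c2"
      unfolding V_def by auto
    then have "\<bar>x - a\<bar> < r" using s t by auto
    then have "\<bar>\<phi> x z - z\<bar> < e / 4" "\<bar>x - a\<bar> < e / 4"
      using d q by (auto simp: r_def)
    then have "\<bar>a - x\<bar> + \<bar>y - z\<bar> < e"
      using q c1 c2 by linarith
    then show "q \<in> ball (a, y) e"
      using sqrt_sum_squares_le_sum_abs[of "a - x" "y - z"]
      by (simp add: q dist_Pair_Pair dist_real_def)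
  qed
  ultimately show ?thesis by blast
qed

section \<open>Countable sets of reals, clopen sets and limits\<close>

lemma nontrivial_interval_minus_countable:
  assumes "nontrivial_interval I" "countable Q" "x \<in> I" "u < x" "x < v"
  shows "\<exists>x'\<in>I - Q. u < x' \<and> x' < v"
proof -
  obtain b where b: "b \<in> I" "b \<noteq> x"
    using assms(1) unfolding nontrivial_interval_def by (metis less_irrefl)
  have I: "is_interval I" using assms(1) unfolding nontrivial_interval_def by blast
  \<comment> \<open>As \<open>x\<close> may be an endpoint of \<open>I\<close>, the open interval is
    taken on the side of another point \<open>b\<close> of \<open>I\<close>.\<close>
  obtain l m where lm: "l < m" "{l<..<m} \<subseteq> I" "u \<le> l" "m \<le> v"
  proof (cases "b < x")
    case True
    then have "{max b u<..<x} \<subseteq> I"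
      using mem_is_interval_1_I[OF I b(1) assms(3)] by auto
    with True assms show ?thesis by (intro that[of "max b u" x]) auto
  next
    case False
    then have "{x<..<min b v} \<subseteq> I"
      using mem_is_interval_1_I[OF I assms(3) b(1)] by auto
    with False b assms show ?thesis by (intro that[of x "min b v"]) auto
  qed
  have "\<not> {l<..<m} \<subseteq> Q"
    using assms(2) lm(1) uncountable_open_interval countable_subset by blast
  with lm show ?thesis by force
qed

text \<open>Otherwise \<open>Z\<close> is a non-empty perfect set in a completely metrizable space,
  hence at least as large as the real line.\<close>

lemma countable_closed_isolated_point:
  fixes Z :: "real set"
  assumes "closed Z" "countable Z" "Z \<noteq> {}"
  obtains a where "a \<in> Z" "\<not> a islimpt Z"
proof -
  have "\<not> (\<forall>a\<in>Z. a islimpt Z)"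
  proof
    assume "\<forall>a\<in>Z. a islimpt Z"
    moreover have "x \<in> euclidean derived_set_of Z \<longleftrightarrow> x islimpt Z" for x
      unfolding in_derived_set_of islimpt_def by auto
    ultimately have "euclidean derived_set_of Z = Z"
      using assms(1) closed_limpt by blast
    then have "(UNIV :: real set) \<lesssim> Z"
      using assms(3) by (intro lepoll_perfect_set[of euclidean])
        (auto simp: completely_metrizable_space_euclidean)
    then show False
      using assms(2) uncountable_UNIV_real countable_lepoll by blast
  qed
  with that show thesis by blast
qed

lemma closedin_eventually_limit:
  fixes s :: "nat \<Rightarrow> 'a::topological_space"
  assumes "closedin (top_of_set H) A" "p \<in> H" "s \<longlonglongrightarrow> p" "\<forall>\<^sub>F j in sequentially. s j \<in> A"
  shows "p \<in> A"
proof -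
  obtain T where T: "closed T" "A = H \<inter> T"
    using assms(1) unfolding closedin_closed by blast
  have "p \<in> T"
    using T assms(3,4) by (intro Lim_in_closed_set[of T s sequentially]) (auto elim: eventually_mono)
  then show ?thesis using T assms(2) by blast
qed

text \<open>A clopen subset of \<open>F\<close> inside the interior \<open>W\<close> is open in
  \<open>H\<close> through \<open>W\<close> and closed in \<open>H\<close> through \<open>F\<close>.
  Removing a second point \<open>q'\<close> from \<open>W\<close> keeps it a proper subset of
  \<open>H\<close>.\<close>

lemma zero_dimensional_imp_empty_interior:
  fixes H F :: "'a::metric_space set"
  assumes "connected H" "p \<in> H" "q \<in> H" "p \<noteq> q"
    and F: "closedin (top_of_set H) F" "zero_dimensional_space (top_of_set F)"
  shows "top_of_set H interior_of F = {}"
proof (rule ccontr)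
  define W where "W = top_of_set H interior_of F"
  assume "\<not> ?thesis"
  then obtain w where "w \<in> W" unfolding W_def by auto
  have W: "openin (top_of_set H) W" "W \<subseteq> F"
    unfolding W_def by (rule openin_interior_of, rule interior_of_subset)
  have "F \<subseteq> H" by (rule closedin_imp_subset[OF F(1)])
  obtain q' where q': "q' \<in> H" "q' \<noteq> w"
  proof (cases "p = w")
    case True
    with assms(3,4) show ?thesis by (intro that[of q]) auto
  next
    case False
    with assms(2) show ?thesis by (intro that[of p]) auto
  qed
  have "openin (top_of_set F) (W - {q'})"
    by (intro openin_delete openin_subset_trans[OF W \<open>F \<subseteq> H\<close>])
  moreover have "w \<in> W - {q'}" using \<open>w \<in> W\<close> q' by simp
  ultimately obtain V where V: "openin (top_of_set F) V" "closedin (top_of_set F) V" "w \<in> V" "V \<subseteq> W - {q'}"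
    using F(2)[unfolded zero_dimensional_space_iff] by meson
  have "openin (top_of_set W) V"
    using V(1) by (rule openin_subset_trans) (use V(4) W(2) in auto)
  then have "openin (top_of_set H) V"
    using W(1) by (rule openin_trans)
  moreover have "closedin (top_of_set H) V"
    using V(2) F(1) by (rule closedin_trans)
  ultimately have "V = {} \<or> V = H"
    using assms(1) unfolding connected_clopen by simp
  then show False using V q' by auto
qed

text \<open>The estimate passes to limits because \<open>g\<close> is continuous at every
  \<open>x\<close> other than \<open>a\<close>. It is thereby carried from the graph to its closure,
  in particular to points over the rest of \<open>Q\<close>.\<close>

lemma cluster_set_near:
  assumes "P \<subseteq> I" "continuous_on (I - {a}) g"
    and near: "\<And>x. x \<in> P \<Longrightarrow> x \<noteq> a \<Longrightarrow> \<bar>x - a\<bar> < d \<Longrightarrow> \<bar>f x - g x\<bar> \<le> e"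
    and x: "x \<in> I" "x \<noteq> a" "\<bar>x - a\<bar> < d" and z: "z \<in> cluster_set P f x"
  shows "\<bar>z - g x\<bar> \<le> e"
proof -
  obtain s where s: "\<And>j. s j \<in> P" "s \<longlonglongrightarrow> x" "(\<lambda>j. f (s j)) \<longlonglongrightarrow> z"
    using z unfolding cluster_set_def by blast
  have ev: "\<forall>\<^sub>F j in sequentially. s j \<in> - {a} \<inter> {a - d<..<a + d}"
    using x by (intro topological_tendstoD[OF s(2)]) auto
  have "(\<lambda>j. g (s j)) \<longlonglongrightarrow> g x"
    using ev s(1) assms(1) x
    by (intro continuous_on_tendsto_compose[OF assms(2) s(2)]) (auto elim!: eventually_mono)
  then have "(\<lambda>j. \<bar>f (s j) - g (s j)\<bar>) \<longlonglongrightarrow> \<bar>z - g x\<bar>"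
    using s(3) by (intro tendsto_rabs tendsto_diff)
  moreover have "\<forall>\<^sub>F j in sequentially. \<bar>f (s j) - g (s j)\<bar> \<le> e"
    using ev by eventually_elim (use s(1) in \<open>auto intro!: near\<close>)
  ultimately show ?thesis
    by (intro tendsto_upperbound) auto
qed

section \<open>Hypergraphs and their connectedness\<close>

locale hypergraph_data =
  fixes H :: "(real \<times> real) set" and I Q :: "real set" and f :: "real \<Rightarrow> real"
  assumes I: "nontrivial_interval I"
    and Q: "countable Q"
    and cont: "continuous_on (I - Q) f"
    and cluster_nonempty: "a \<in> Q \<Longrightarrow> cluster_set (I - Q) f a \<noteq> {}"
    and left: "a \<in> Q \<Longrightarrow> \<exists>x\<in>I. x < a \<Longrightarrow> cluster_set (I - Q) f a = cluster_set_left (I - Q) f a"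
    and right: "a \<in> Q \<Longrightarrow> \<exists>x\<in>I. a < x \<Longrightarrow> cluster_set (I - Q) f a = cluster_set_right (I - Q) f a"
    and approx: "a \<in> Q \<Longrightarrow> \<exists>g l. continuous_on (I - {a}) g \<and>
                   ((\<lambda>x. f x - g x) \<longlongrightarrow> l) (at a within (I - Q))"
    and H: "graph_on (I - Q) f \<subseteq> H" "H \<subseteq> closure (graph_on (I - Q) f)" "H \<subseteq> I \<times> UNIV"
    and section_dense: "a \<in> Q \<Longrightarrow>
          top_of_set (vsection (closure (graph_on (I - Q) f)) a) closure_of vsection H a =
            vsection (closure (graph_on (I - Q) f)) a"
    and section_interior: "a \<in> Q \<Longrightarrow>
          top_of_set (vsection (closure (graph_on (I - Q) f)) a) interior_of vsection H a = {}"

lemma hypergraph_dataE: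
  assumes "hypergraph H"
  obtains I Q f where "hypergraph_data H I Q f"
proof -
  note * = assms[unfolded hypergraph_def Let_def]
  from * show thesis
  proof (elim exE conjE, goal_cases)
    case (1 I Q f)
    show thesis
    proof (rule that[of I Q f], unfold_locales, goal_cases)
      case (4 a)
      then show ?case using 1(5) unfolding nontrivial_interval_def by blast
    qed (use 1 in simp_all)
  qed
qed

context hypergraph_data
begin

lemma section_nonempty:
  assumes "a \<in> Q"
  shows "\<exists>y. (a, y) \<in> H"
proof -
  obtain y where "y \<in> cluster_set (I - Q) f a"
    using cluster_nonempty[OF assms] by blast
  then have "y \<in> vsection (closure (graph_on (I - Q) f)) a"
    unfolding vsection_def by (simp add: closure_graph_on_iff)
  then have "vsection H a \<noteq> {}"
    using section_dense[OF assms] by auto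
  then show ?thesis unfolding vsection_def by blast
qed

text \<open>Between \<open>u\<close> and \<open>v\<close> the graph has to switch parts. Continuity
  of \<open>f\<close> allows this only over \<open>Q\<close>, where the equality of the one-sided
  cluster sets forbids it.\<close>

lemma no_separation:
  assumes A: "closedin (top_of_set H) A" and B: "closedin (top_of_set H) B"
    and AB: "A \<union> B = H" "A \<inter> B = {}"
    and u: "u \<in> I - Q" "(u, f u) \<in> A" and v: "v \<in> I - Q" "(v, f v) \<in> B" and "u < v"
  shows False
proof -
  define P where "P = I - Q"
  define PA where "PA = {x \<in> P. (x, f x) \<in> A}"
  define PB where "PB = {x \<in> P. (x, f x) \<in> B}"
  have graph: "(x, f x) \<in> H" if "x \<in> P" for x
    using that H(1) unfolding graph_on_def P_def by blast
  have P: "P = PA \<union> PB"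
    unfolding PA_def PB_def using graph AB by auto
  have limit: "(x, f x) \<in> C"
    if "x \<in> P" "x \<in> closure {x \<in> P. (x, f x) \<in> C}" "closedin (top_of_set H) C" for x C
  proof -
    obtain s where s: "\<And>n. s n \<in> P" "\<And>n. (s n, f (s n)) \<in> C" "s \<longlonglongrightarrow> x"
      using \<open>x \<in> closure _\<close> unfolding closure_sequential by auto
    have "(\<lambda>n. f (s n)) \<longlonglongrightarrow> f x"
      using cont that(1) s unfolding P_def by (auto intro: continuous_on_tendsto_compose)
    then have "(\<lambda>n. (s n, f (s n))) \<longlonglongrightarrow> (x, f x)"
      using s(3) by (rule tendsto_Pair[rotated])
    then show ?thesis
      using closedin_eventually_limit[OF that(3) graph[OF that(1)]] s(2) by auto
  qed
  \<comment> \<open>Intersecting with \<open>{u..v}\<close> makes \<open>Z\<close> closed in the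
    real line and not merely in \<open>I\<close>. Once \<open>Z\<close> is known to lie in
    \<open>Q\<close>, its points differ from \<open>u\<close> and \<open>v\<close>, so both
    one-sided cluster sets are available there.\<close>
  define Z where "Z = {u..v} \<inter> closure PA \<inter> closure PB"
  have "Z \<inter> P = {}"
    using limit[of _ A] limit[of _ B] A B AB(2) unfolding Z_def PA_def PB_def by blast
  have "{u..v} \<subseteq> I"
    using I u v unfolding nontrivial_interval_def by (auto intro: mem_is_interval_1_I)
  then have "Z \<subseteq> Q"
    using \<open>Z \<inter> P = {}\<close> unfolding Z_def P_def by blast
  have "I \<subseteq> closure P"
  proof
    fix x assume "x \<in> I"
    show "x \<in> closure P"
      unfolding closure_approachable P_def
    proof (intro allI impI)
      fix e :: real assume "e > 0"
      then show "\<exists>x'\<in>I - Q. dist x' x < e"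
        using nontrivial_interval_minus_countable[OF I Q \<open>x \<in> I\<close>, of "x - e" "x + e"]
        by (auto simp: dist_real_def abs_less_iff algebra_simps)
    qed
  qed
  then have cover: "{u..v} \<subseteq> closure PA \<union> closure PB"
    using \<open>{u..v} \<subseteq> I\<close> by (simp add: P closure_Un)
  \<comment> \<open>Away from \<open>Z\<close> the two closures are disjoint and cover
    \<open>J\<close>, so a connected \<open>J\<close> meets only one of them.\<close>
  have split: "J \<inter> PA = {} \<or> J \<inter> PB = {}" if "connected J" "J \<subseteq> {u..v}" "J \<inter> Z = {}" for J
  proof -
    have "closure PA \<inter> J = {} \<or> closure PB \<inter> J = {}"
      using that cover unfolding Z_def
      by (intro connected_closedD) auto
    then show ?thesis using closure_subset by blast
  qed
  have "u \<in> {u..v} \<inter> PA" "v \<in> {u..v} \<inter> PB"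
    using u v \<open>u < v\<close> by (auto simp: PA_def PB_def P_def)
  then have "Z \<noteq> {}"
    using split[OF connected_Icc subset_refl] by blast
  moreover have "closed Z" unfolding Z_def by auto
  ultimately obtain a where a: "a \<in> Z" "\<not> a islimpt Z"
    using countable_closed_isolated_point countable_subset[OF \<open>Z \<subseteq> Q\<close> Q] by blast
  obtain e where e: "e > 0" "\<And>x. x \<in> Z \<Longrightarrow> dist x a < e \<Longrightarrow> x = a"
    using a(2) unfolding islimpt_approachable by blast
  have "a \<in> Q" "a \<notin> P" using a(1) \<open>Z \<subseteq> Q\<close> P_def by auto
  then have "a \<noteq> u" "a \<noteq> v" "a \<in> {u..v}"
    using a(1) u(1) v(1) unfolding Z_def by auto
  then have "u < a" "a < v" by simp_all
  \<comment> \<open>This radius keeps \<open>L\<close> and \<open>R\<close> inside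
    \<open>{u..v}\<close> and disjoint from \<open>Z\<close>.\<close>
  define r where "r = min e (min (a - u) (v - a))"
  have "r > 0" using e \<open>u < a\<close> \<open>a < v\<close> by (simp add: r_def)
  define L where "L = {a - r<..<a}"
  define R where "R = {a<..<a + r}"
  have "L \<inter> PA = {} \<or> L \<inter> PB = {}"
    using e(2) by (intro split) (fastforce simp: L_def r_def dist_real_def)+
  moreover have "R \<inter> PA = {} \<or> R \<inter> PB = {}"
    using e(2) by (intro split) (fastforce simp: R_def r_def dist_real_def)+
  moreover have "L \<inter> C \<noteq> {} \<or> R \<inter> C \<noteq> {}" if "a \<in> closure C" "C \<subseteq> P" for C
  proof -
    obtain x where "x \<in> C" "dist x a < r"
      using \<open>a \<in> closure C\<close> \<open>r > 0\<close> unfolding closure_approachable by blast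
    moreover have "x \<noteq> a" using \<open>x \<in> C\<close> that \<open>a \<notin> P\<close> by blast
    ultimately show ?thesis
      unfolding L_def R_def dist_real_def by (cases "x < a") force+
  qed
  then have "L \<inter> PA \<noteq> {} \<or> R \<inter> PA \<noteq> {}" "L \<inter> PB \<noteq> {} \<or> R \<inter> PB \<noteq> {}"
    using a(1) unfolding Z_def PA_def PB_def by auto
  \<comment> \<open>Each side carries at most one part, and each part occurs on some side because it
    accumulates at \<open>a\<close>, which is not in \<open>P\<close>.\<close>
  ultimately have sides: "L \<inter> PA = {} \<and> R \<inter> PB = {} \<or> L \<inter> PB = {} \<and> R \<inter> PA = {}"
    by blast
  obtain y where y: "(a, y) \<in> H"
    using section_nonempty \<open>a \<in> Q\<close> by blast
  then have y_cluster: "y \<in> cluster_set P f a"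
    using H(2) closure_graph_on_iff unfolding P_def by blast
  have limit_in: "(a, y) \<in> C"
    if "closedin (top_of_set H) C" "\<And>j. x j \<in> P" "x \<longlonglongrightarrow> a" "(\<lambda>j. f (x j)) \<longlonglongrightarrow> y"
      "\<forall>\<^sub>F j in sequentially. x j \<in> J" "\<And>x. x \<in> J \<inter> P \<Longrightarrow> (x, f x) \<in> C" for x J C
    using that(2,5,6) by (intro closedin_eventually_limit[OF that(1) y tendsto_Pair[OF that(3,4)]])
      (auto elim!: eventually_mono)
  have "y \<in> cluster_set_left P f a"
    using left[OF \<open>a \<in> Q\<close>] u(1) \<open>u < a\<close> y_cluster unfolding P_def by auto
  then obtain xl where xl: "\<And>j. xl j \<in> P" "\<And>j. xl j \<le> a" "xl \<longlonglongrightarrow> a" "(\<lambda>j. f (xl j)) \<longlonglongrightarrow> y"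
    unfolding cluster_set_left_def by auto
  have "xl j < a" for j
    using xl(1,2)[of j] \<open>a \<notin> P\<close> by (cases "xl j = a") auto
  then have xl_in: "\<forall>\<^sub>F j in sequentially. xl j \<in> L"
    using order_tendstoD(1)[OF xl(3), of "a - r"] \<open>r > 0\<close> unfolding L_def
    by (auto elim: eventually_mono)
  have "y \<in> cluster_set_right P f a"
    using right[OF \<open>a \<in> Q\<close>] v(1) \<open>a < v\<close> y_cluster unfolding P_def by auto
  then obtain xr where xr: "\<And>j. xr j \<in> P" "\<And>j. xr j \<ge> a" "xr \<longlonglongrightarrow> a" "(\<lambda>j. f (xr j)) \<longlonglongrightarrow> y"
    unfolding cluster_set_right_def by auto
  have "xr j > a" for j
    using xr(1,2)[of j] \<open>a \<notin> P\<close> by (cases "xr j = a") auto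
  then have xr_in: "\<forall>\<^sub>F j in sequentially. xr j \<in> R"
    using order_tendstoD(2)[OF xr(3), of "a + r"] \<open>r > 0\<close> unfolding R_def
    by (auto elim: eventually_mono)
  have PA_D: "\<And>x. x \<in> PA \<Longrightarrow> (x, f x) \<in> A" and PB_D: "\<And>x. x \<in> PB \<Longrightarrow> (x, f x) \<in> B"
    by (auto simp: PA_def PB_def)
  note limit_left = limit_in[OF _ xl(1,3,4) xl_in] and limit_right = limit_in[OF _ xr(1,3,4) xr_in]
  \<comment> \<open>The same \<open>y\<close> is approached from the left within one part and from
    the right within the other, and both parts are closed in \<open>H\<close>.\<close>
  have "(a, y) \<in> A \<inter> B"
    using sides
  proof
    assume "L \<inter> PA = {} \<and> R \<inter> PB = {}"
    then have "x \<in> L \<inter> P \<Longrightarrow> (x, f x) \<in> B" "x \<in> R \<inter> P \<Longrightarrow> (x, f x) \<in> A" for x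
      using P PA_D PB_D by blast+
    then show ?thesis using limit_left[OF B] limit_right[OF A] by blast
  next
    assume "L \<inter> PB = {} \<and> R \<inter> PA = {}"
    then have "x \<in> L \<inter> P \<Longrightarrow> (x, f x) \<in> A" "x \<in> R \<inter> P \<Longrightarrow> (x, f x) \<in> B" for x
      using P PA_D PB_D by blast+
    then show ?thesis using limit_left[OF A] limit_right[OF B] by blast
  qed
  then show False using AB by blast
qed

text \<open>Since \<open>H\<close> lies in the closure of the graph, every non-empty open subset of
  \<open>H\<close> contains a graph point. A proper non-empty clopen set and its complement thus
  supply the two points for \<open>no_separation\<close>, in one order or the other.\<close>

lemma connected_H: "connected H"
proof -
  have hits: "\<exists>x\<in>I - Q. (x, f x) \<in> V" if V: "openin (top_of_set H) V" "V \<noteq> {}" for V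
  proof -
    obtain T where T: "open T" "V = H \<inter> T" using V(1) unfolding openin_open by blast
    with V(2) H(2) have "closure (graph_on (I - Q) f) \<inter> T \<noteq> {}" by blast
    then have "graph_on (I - Q) f \<inter> T \<noteq> {}"
      using T(1) open_Int_closure_eq_empty by blast
    then show ?thesis using T(2) H(1) unfolding graph_on_def by blast
  qed
  show ?thesis
    unfolding connected_clopen
  proof (intro allI impI)
    fix V assume V: "openin (top_of_set H) V \<and> closedin (top_of_set H) V"
    show "V = {} \<or> V = H"
    proof (rule ccontr)
      assume "\<not> (V = {} \<or> V = H)"
      have "V \<subseteq> H" using V openin_imp_subset by blast
      have W: "openin (top_of_set H) (H - V)" "closedin (top_of_set H) (H - V)"
        using V by (auto intro: openin_diff closedin_diff)
      obtain u where u: "u \<in> I - Q" "(u, f u) \<in> V"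
        using hits[of V] V \<open>\<not> _\<close> by auto
      obtain v where v: "v \<in> I - Q" "(v, f v) \<in> H - V"
        using hits[OF W(1)] \<open>\<not> _\<close> \<open>V \<subseteq> H\<close> by auto
      have "u \<noteq> v" using u v by blast
      then consider "u < v" | "v < u" by linarith
      then show False
      proof cases
        case 1
        then show False
          using no_separation[of V "H - V" u v] V W(2) u v \<open>V \<subseteq> H\<close> by auto
      next
        case 2
        then show False
          using no_separation[of "H - V" V v u] V W(2) u v \<open>V \<subseteq> H\<close> by auto
      qed
    qed
  qed
qed

section \<open>Closed sets with empty interior\<close>

lemma empty_interior_imp_zero_dimensional:
  assumes F: "closedin (top_of_set H) F" "top_of_set H interior_of F = {}"
  shows "zero_dimensional_space (top_of_set F)"
proof -
  define P where "P = I - Q"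
  have FH: "F \<subseteq> H" using F(1) closedin_imp_subset by blast
  have F_cluster: "x \<in> I" "z \<in> cluster_set P f x" if "(x, z) \<in> F" for x z
    using that FH H(2,3) by (auto simp: P_def closure_graph_on_iff[symmetric])
  \<comment> \<open>Points outside \<open>I\<close> are included so that \<open>D\<close> can be
    dense in the whole line, as \<open>step_approximation\<close> requires.\<close>
  define D where "D = {x. x \<in> I \<longrightarrow> x \<in> P \<and> (x, f x) \<notin> F}"
  have D: "x \<notin> D" if "(x, z) \<in> F" for x z
  proof
    assume "x \<in> D"
    then have "x \<in> P" "(x, f x) \<notin> F" using F_cluster(1)[OF that] unfolding D_def by auto
    moreover have "z = f x"
      using cluster_set_continuous[OF cont] F_cluster(2)[OF that] \<open>x \<in> P\<close> by (simp add: P_def)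
    ultimately show False using that by blast
  qed
  have dense: "\<exists>d\<in>D. u < d \<and> d < v" if "u < v" for u v
  proof (rule ccontr)
    \<comment> \<open>An interval free of \<open>D\<close> lies in \<open>I\<close>, and all graph
      points over it belong to \<open>F\<close>. As \<open>F\<close> is closed in \<open>H\<close>,
      it then contains the whole strip of \<open>H\<close> over that interval, which is non-empty
      and open in \<open>H\<close>.\<close>
    assume no: "\<not> ?thesis"
    let ?T = "{u<..<v} \<times> (UNIV :: real set)"
    have "open ?T" by (intro open_Times) auto
    obtain m where m: "u < m" "m < v" using \<open>u < v\<close> dense_order_class.dense by blast
    then have "m \<in> I" using no unfolding D_def by blast
    then obtain x where x: "x \<in> P" "u < x" "x < v"
      using nontrivial_interval_minus_countable[OF I Q _ m] unfolding P_def by blast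
    have "graph_on P f \<inter> ?T \<subseteq> F"
      using no unfolding D_def graph_on_def by fastforce
    then have "?T \<inter> closure (graph_on P f) \<subseteq> closure F"
      using open_Int_closure_subset[OF \<open>open ?T\<close>, of "graph_on P f"]
        closure_mono[of "?T \<inter> graph_on P f" F] by blast
    moreover obtain C where "closed C" "F = H \<inter> C"
      using F(1) unfolding closedin_closed by blast
    moreover from this have "closure F \<subseteq> C"
      by (intro closure_minimal) auto
    ultimately have "H \<inter> ?T \<subseteq> F"
      using H(2) unfolding P_def by blast
    then have "H \<inter> ?T \<subseteq> top_of_set H interior_of F"
      using \<open>open ?T\<close> by (intro interior_of_maximal openin_open_Int)
    moreover have "(x, f x) \<in> H \<inter> ?T"
      using x H(1) unfolding P_def graph_on_def by auto
    ultimately show False using F(2) by blast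
  qed
  have small: "\<exists>V. openin (top_of_set F) V \<and> closedin (top_of_set F) V \<and> (a, y) \<in> V \<and> V \<subseteq> ball (a, y) e"
    if ay: "(a, y) \<in> F" and "e > 0" for a y e
  proof -
    \<comment> \<open>For \<open>a\<close> in \<open>Q\<close> the limit \<open>l\<close> is
      absorbed into \<open>g\<close>; for other \<open>a\<close> the constant \<open>f a\<close>
      serves.\<close>
    have "\<exists>g. continuous_on (I - {a}) g \<and> ((\<lambda>x. f x - g x) \<longlongrightarrow> 0) (at a within P)"
    proof (cases "a \<in> Q")
      case True
      then obtain g l where "continuous_on (I - {a}) g" "((\<lambda>x. f x - g x) \<longlongrightarrow> l) (at a within P)"
        using approx[OF True] unfolding P_def by auto
      then show ?thesis
        using tendsto_diff[of "\<lambda>x. f x - g x" l "at a within P" "\<lambda>_. l" l]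
        by (intro exI[of _ "\<lambda>x. g x + l"]) (auto intro: continuous_intros simp: algebra_simps)
    next
      case False
      then have "(f \<longlongrightarrow> f a) (at a within P)"
        using cont F_cluster(1)[OF ay] unfolding P_def by (simp add: continuous_on_def)
      then show ?thesis
        by (intro exI[of _ "\<lambda>_. f a"]) (auto simp: LIM_zero_iff)
    qed
    then obtain g where g: "continuous_on (I - {a}) g" "((\<lambda>x. f x - g x) \<longlongrightarrow> 0) (at a within P)"
      by blast
    \<comment> \<open>The limit at \<open>a\<close> controls graph points only;
      \<open>cluster_set_near\<close> extends the bound to all of \<open>F\<close>, whose heights
      are cluster values.\<close>
    have near: "\<exists>d>0. \<forall>x z. (x, z) \<in> F \<and> x \<noteq> a \<and> \<bar>x - a\<bar> < d \<longrightarrow> \<bar>z - g x\<bar> \<le> r" if "r > 0" for r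
    proof -
      obtain d where "d > 0" "\<forall>x\<in>P. x \<noteq> a \<and> dist x a < d \<longrightarrow> dist (f x - g x) 0 < r"
        using tendstoD[OF g(2) \<open>r > 0\<close>] unfolding eventually_at by blast
      then have d: "d > 0" "\<And>x. x \<in> P \<Longrightarrow> x \<noteq> a \<Longrightarrow> \<bar>x - a\<bar> < d \<Longrightarrow> \<bar>f x - g x\<bar> \<le> r"
        by (auto simp: dist_real_def intro: less_imp_le)
      have "\<bar>z - g x\<bar> \<le> r" if "(x, z) \<in> F" "x \<noteq> a" "\<bar>x - a\<bar> < d" for x z
        using cluster_set_near[OF _ g(1) d(2) F_cluster(1)[OF that(1)] that(2,3) F_cluster(2)[OF that(1)]]
        by (auto simp: P_def)
      with d(1) show ?thesis by auto
    qed
    \<comment> \<open>Over \<open>Q\<close>, an interval inside the section of \<open>F\<close>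
      would be relatively open in the section of the closed graph, against the empty interior of
      \<open>vsection H a\<close>. Over the other points the section of \<open>F\<close> has at most
      one element.\<close>
    have gap: "\<exists>c. u < c \<and> c < v \<and> (a, c) \<notin> F" if "u < v" for u v
    proof (cases "a \<in> Q")
      case True
      show ?thesis
      proof (rule ccontr)
        let ?S = "vsection (closure (graph_on (I - Q) f)) a"
        assume "\<not> ?thesis"
        then have sub: "{u<..<v} \<subseteq> vsection H a"
          using FH unfolding vsection_def by auto
        also have "\<dots> \<subseteq> ?S"
          using H(2) unfolding vsection_def by blast
        finally have "openin (top_of_set ?S) {u<..<v}"
          by (simp add: open_subset)
        then have "{u<..<v} \<subseteq> top_of_set ?S interior_of vsection H a"
          using sub by (intro interior_of_maximal)
        then show False using section_interior[OF True] that by simp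
      qed
    next
      case False
      then have "c = f a" if "(a, c) \<in> F" for c
        using cluster_set_continuous[OF cont] F_cluster[OF that] False by (simp add: P_def)
      moreover obtain c where "u < c" "c < v" "c \<noteq> f a"
        using real_interval_avoid_countable_set[OF \<open>u < v\<close>, of "{f a}"] by auto
      ultimately show ?thesis by blast
    qed
    have "F \<subseteq> I \<times> UNIV" using F_cluster(1) by auto
    then show ?thesis
      using D dense g(1) near gap ay \<open>e > 0\<close> by (rule small_clopen_neighbourhood)
  qed
  show ?thesis
    unfolding zero_dimensional_space_iff
  proof (intro allI impI)
    fix U p assume U: "openin (top_of_set F) U \<and> p \<in> U"
    then obtain e where e: "e > 0" "ball p e \<inter> F \<subseteq> U"
      unfolding openin_contains_ball by blast
    have "p \<in> F" using U openin_imp_subset by blast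
    then obtain V where "openin (top_of_set F) V" "closedin (top_of_set F) V" "p \<in> V" "V \<subseteq> ball p e"
      using small[of "fst p" "snd p"] e(1) by auto
    then show "\<exists>V. openin (top_of_set F) V \<and> closedin (top_of_set F) V \<and> p \<in> V \<and> V \<subseteq> U"
      using e(2) openin_imp_subset[where S = F and T = V] by (intro exI[of _ V]) auto
  qed
qed

text \<open>A one-point space is both connected and zero-dimensional, so the connectedness argument
  needs a second point.\<close>

lemma two_points:
  obtains p q where "p \<in> H" "q \<in> H" "p \<noteq> q"
proof -
  obtain x y where xy: "x \<in> I" "y \<in> I" "x < y"
    using I(1) unfolding nontrivial_interval_def by blast
  obtain x' where x': "x' \<in> I - Q" "x' < (x + y) / 2"
    using nontrivial_interval_minus_countable[OF I Q xy(1), of "x - 1" "(x + y) / 2"] xy(3) by auto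
  obtain y' where y': "y' \<in> I - Q" "y' > (x + y) / 2"
    using nontrivial_interval_minus_countable[OF I Q xy(2), of "(x + y) / 2" "y + 1"] xy(3) by auto
  show ?thesis
    using that[of "(x', f x')" "(y', f y')"] x' y' H(1) unfolding graph_on_def by auto
qed

end

theorem theorem1p6:
  fixes H F :: "(real \<times> real) set"
  assumes "hypergraph H"
    and "closedin (top_of_set H) F"
  shows "zero_dimensional_space (top_of_set F) \<longleftrightarrow> top_of_set H interior_of F = {}"
proof -
  obtain I Q f where "hypergraph_data H I Q f"
    using hypergraph_dataE[OF assms(1)] .
  then interpret hypergraph_data H I Q f .
  obtain p q where pq: "p \<in> H" "q \<in> H" "p \<noteq> q"
    by (rule two_points)
  show ?thesis
    using zero_dimensional_imp_empty_interior[OF connected_H pq assms(2)]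
      empty_interior_imp_zero_dimensional[OF assms(2)] by blast
qed

end
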